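(* Let $b,c\in\mathbb{C}$ with $|b|=|c|=1$ and $b\overline c\in\mathbb{R}$, and let $\alpha\in\mathbb{C}$ with $|\alpha|=1$. The extension domain described via a rank-one perturbation, $\operatorname{Dom}(K_{1,\alpha})$, and the extension domain described by boundary conditions, $\operatorname{Dom}(K_1(b,c))$, coincide, i.e. $\operatorname{Dom}(K_{1,\alpha})=\operatorname{Dom}(K_1(b,c))$, when $$\alpha=\frac{b+c\sqrt{-i}}{b-c\sqrt{i}}.$$
   Context: $K_1=-\frac{d^2}{dx^2}$ on $L^2(0,\infty)$. Maximal domain: $\operatorname{Dom}(K_{1,\max})=\{f\in L^2(0,\infty): f,f'\in AC_{loc}(0,\infty),\ f''\in L^2(0,\infty)\}$; for such $f$ the limits $f(0)=\lim_{x\to0^+}f(x)$ and $f'(0)=\lim_{x\to0^+}f'(x)$ exist. Minimal domain: $\operatorname{Dom}(K_{1,\min})=\{f\in\operatorname{Dom}(K_{1,\max}): f(0)=f'(0)=0\}$, and $K_{1,\min}^*=K_{1,\max}$. The defect spaces $\ker(K_{1,\max}-iI)$ and $\ker(K_{1,\max}+iI)$ are one-dimensional, spanned by the normalized vectors $\phi^+(x)=\sqrt[4]{2}\,e^{\sqrt{-i}\,x}$ and $\phi^-(x)=\sqrt[4]{2}\,e^{-\sqrt{i}\,x}$ respectively. Here $\sqrt i=e^{i\pi/4}$, and $\sqrt{-i}$ denotes the square root of $-i$ with negative real part, $\sqrt{-i}=e^{3\pi i/4}$, so that $\phi^+\in L^2(0,\infty)$. Rank-one description: $\operatorname{Dom}(K_{1,\alpha})=\operatorname{Dom}(K_{1,\min})+\operatorname{span}\{\alpha\phi^--\phi^+\}$.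 Boundary-condition description: $\operatorname{Dom}(K_1(b,c))=\{f\in\operatorname{Dom}(K_{1,\max}): b f(0)+c f'(0)=0\}$. *)

theory Defs
  imports "HOL-Analysis.Analysis"
begin

(* Elements of L^2(0,\<infinity>) are represented by functions on the whole of \<real>; only their
   restriction to {0<..} matters. In the domains below each element is represented by
   its locally absolutely continuous representative on {0<..}. *)

definition L2_halfline :: "(real \<Rightarrow> complex) \<Rightarrow> bool" where
  "L2_halfline f \<longleftrightarrow>
     f \<in> borel_measurable (lebesgue_on {0<..}) \<and>
     integrable (lebesgue_on {0<..}) (\<lambda>x. (cmod (f x))\<^sup>2)"

definition abs_continuous_on_interval :: "real \<Rightarrow> real \<Rightarrow> (real \<Rightarrow> complex) \<Rightarrow> bool" where
  "abs_continuous_on_interval a b f \<longleftrightarrow>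
     (\<forall>\<epsilon>>0. \<exists>\<delta>>0. \<forall>\<D>. \<D> division_of \<Union>\<D> \<and> \<Union>\<D> \<subseteq> {a..b} \<and> (\<Sum>k\<in>\<D>. Sup k - Inf k) < \<delta>
        \<longrightarrow> (\<Sum>k\<in>\<D>. cmod (f (Sup k) - f (Inf k))) < \<epsilon>)"

definition AC_loc_halfline :: "(real \<Rightarrow> complex) \<Rightarrow> bool" where
  "AC_loc_halfline f \<longleftrightarrow> (\<forall>a b. 0 < a \<and> a \<le> b \<longrightarrow> abs_continuous_on_interval a b f)"

definition dx :: "(real \<Rightarrow> complex) \<Rightarrow> real \<Rightarrow> complex" where
  "dx f x = vector_derivative f (at x)"

(* Since dx f is locally absolutely continuous, its derivative f'' exists only almost
   everywhere; f'' \<in> L^2 is expressed through a representative h of f''. *)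
definition Dom_K1_max :: "(real \<Rightarrow> complex) set" where
  "Dom_K1_max = {f. L2_halfline f \<and> AC_loc_halfline f \<and>
     f differentiable_on {0<..} \<and> AC_loc_halfline (dx f) \<and>
     (\<exists>h. L2_halfline h \<and>
        (AE x in lebesgue_on {0<..}. (dx f has_vector_derivative h x) (at x)))}"

(* f(0) and f'(0) are the one-sided limits, not the values at 0 of the representing
   functions. For f \<in> Dom_K1_max both limits exist. *)
definition bval :: "(real \<Rightarrow> complex) \<Rightarrow> complex" where
  "bval f = Lim (at_right 0) f"

definition Dom_K1_min :: "(real \<Rightarrow> complex) set" where
  "Dom_K1_min = {f \<in> Dom_K1_max. bval f = 0 \<and> bval (dx f) = 0}"

definition sqrt_i :: complex where
  "sqrt_i = cis (pi / 4)"

(* The square root of -\<i> with negative real part, so not the principal value csqrt (-\<i>). *)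
definition sqrt_minus_i :: complex where
  "sqrt_minus_i = cis (3 * pi / 4)"

definition phi_plus :: "real \<Rightarrow> complex" where
  "phi_plus x = of_real (root 4 2) * exp (sqrt_minus_i * of_real x)"

definition phi_minus :: "real \<Rightarrow> complex" where
  "phi_minus x = of_real (root 4 2) * exp (- sqrt_i * of_real x)"

definition Dom_K1_rank_one :: "complex \<Rightarrow> (real \<Rightarrow> complex) set" where
  "Dom_K1_rank_one \<alpha> =
     {\<lambda>x. g x + k * (\<alpha> * phi_minus x - phi_plus x) | g k. g \<in> Dom_K1_min}"

definition Dom_K1_bc :: "complex \<Rightarrow> complex \<Rightarrow> (real \<Rightarrow> complex) set" where
  "Dom_K1_bc b c = {f \<in> Dom_K1_max. b * bval f + c * bval (dx f) = 0}"

lemma sqrt_i_squared: "sqrt_i\<^sup>2 = \<i>"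
  by (simp add: sqrt_i_def power2_eq_square cis_mult)

lemma sqrt_minus_i_squared: "sqrt_minus_i\<^sup>2 = - \<i>"
proof -
  have "3 * pi / 4 + 3 * pi / 4 = pi + pi / 2"
    by simp
  then have "sqrt_minus_i\<^sup>2 = cis pi * cis (pi / 2)"
    unfolding sqrt_minus_i_def power2_eq_square cis_mult by (rule arg_cong)
  then show ?thesis
    by simp
qed

end

theory Submission
  imports Defs
begin

text \<open>On the maximal domain the boundary values \<open>f(0)\<close> and \<open>f'(0)\<close> exist and are linear in \<open>f\<close>: a
  locally absolutely continuous function is the integral of its derivative, which is integrable near
  \<open>0\<close>. Both domains thus contain the minimal domain, the common kernel of the two boundary values, and
  are determined by the pairs of boundary values that they attain. The value of \<open>\<alpha>\<close> is the one for
  which \<open>\<alpha> \<phi>\<^sup>- - \<phi>\<^sup>+\<close> satisfies the boundary condition, and its boundary values are not both zero.\<close>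

section \<open>Absolutely continuous functions\<close>

text \<open>Two distinct members of a division meet in a convex set with empty interior, which is
  negligible, so measure is additive over them. This turns the total length in the definition of
  absolute continuity into a measure that a covering open set can bound.\<close>

lemma content_division_eq_measure:
  fixes \<D> :: "real set set"
  assumes "\<D> division_of S"
  shows "(\<Sum>K\<in>\<D>. Sup K - Inf K) = measure lebesgue S"
proof -
  have K: "K \<in> lmeasurable \<and> Sup K - Inf K = measure lebesgue K" if "K \<in> \<D>" for K
  proof -
    obtain u v where "K = {u..v}" "u \<le> v"
      using division_ofD(3,4)[OF assms \<open>K \<in> \<D>\<close>] by (metis atLeastatMost_empty_iff box_real(2))
    then show ?thesis by simp
  qed
  have "measure lebesgue (\<Union>\<D>) = (\<Sum>K\<in>\<D>. measure lebesgue K)"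
  proof (rule measure_negligible_finite_Union)
    show "finite \<D>" using assms by blast
    show "pairwise (\<lambda>S T. negligible (S \<inter> T)) \<D>"
    proof (rule pairwiseI)
      fix K L assume KL: "K \<in> \<D>" "L \<in> \<D>" "K \<noteq> L"
      have "convex (K \<inter> L)"
        using division_ofD(4)[OF assms] KL by (metis convex_Int convex_box(1))
      moreover have "interior (K \<inter> L) = {}"
        using division_ofD(5)[OF assms] KL by simp
      ultimately show "negligible (K \<inter> L)"
        using negligible_convex_interior by blast
    qed
  qed (use K in auto)
  then show ?thesis
    using K division_ofD(6)[OF assms] by simp
qed

lemma abs_continuous_on_intervalE:
  assumes "abs_continuous_on_interval a b f" "\<epsilon> > 0"
  obtains \<delta> where "\<delta> > 0"
    "\<And>\<D>. \<lbrakk>\<D> division_of \<Union>\<D>; \<Union>\<D> \<subseteq> {a..b}; (\<Sum>k\<in>\<D>. Sup k - Inf k) < \<delta>\<rbrakk>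
        \<Longrightarrow> (\<Sum>k\<in>\<D>. cmod (f (Sup k) - f (Inf k))) < \<epsilon>"
proof -
  obtain \<delta> where "\<delta> > 0" "\<forall>\<D>. \<D> division_of \<Union>\<D> \<and> \<Union>\<D> \<subseteq> {a..b} \<and> (\<Sum>k\<in>\<D>. Sup k - Inf k) < \<delta>
        \<longrightarrow> (\<Sum>k\<in>\<D>. cmod (f (Sup k) - f (Inf k))) < \<epsilon>"
    using assms(1)[unfolded abs_continuous_on_interval_def, rule_format, OF assms(2)] by (elim exE conjE)
  then show thesis
    by (intro that[of \<delta>]) simp_all
qed

text \<open>Tags outside \<open>N\<close> are handled as in the classical fundamental theorem; the intervals
  tagged in \<open>N\<close> lie in an open set of small measure, where absolute continuity applies.\<close>

lemma fundamental_theorem_of_calculus_abs_continuous: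
  fixes F h :: "_ \<Rightarrow> complex"
  assumes ab: "a \<le> b" and ac: "abs_continuous_on_interval a b F" and N: "negligible N"
    and deriv: "\<And>x. x \<in> {a..b} - N \<Longrightarrow> (F has_vector_derivative h x) (at x within {a..b})"
  shows "(h has_integral (F b - F a)) {a..b}"
proof -
  \<comment> \<open>With value 0 on \<open>N\<close>, an interval tagged in \<open>N\<close>
    contributes only the increment of \<open>F\<close> to the error. The negligible change is undone
    at the end.\<close>
  define h' where "h' x = (if x \<in> N then 0 else h x)" for x
  have "(h' has_integral (F b - F a)) (cbox a b)"
    unfolding has_integral
  proof (intro allI impI)
    fix e :: real assume "e > 0"
    \<comment> \<open>Half of \<open>e\<close> is for tags outside \<open>N\<close>, half for tags
      in \<open>N\<close>. The summand 1 keeps the quotient meaningful when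
      \<open>a = b\<close>.\<close>
    define e1 where "e1 = e / (2 * (b - a + 1))"
    have "e1 > 0" and e1: "e1 * (b - a) \<le> e / 2"
      using \<open>e > 0\<close> ab by (auto simp: e1_def field_simps)
    obtain \<delta> where "\<delta> > 0" and \<delta>: "\<And>\<D>. \<D> division_of \<Union>\<D> \<Longrightarrow> \<Union>\<D> \<subseteq> {a..b} \<Longrightarrow>
        (\<Sum>k\<in>\<D>. Sup k - Inf k) < \<delta> \<Longrightarrow> (\<Sum>k\<in>\<D>. cmod (F (Sup k) - F (Inf k))) < e / 2"
      using abs_continuous_on_intervalE[OF ac half_gt_zero[OF \<open>e > 0\<close>]] by blast
    have N0: "N \<in> null_sets lebesgue"
      using N by (simp add: negligible_iff_null_sets)
    \<comment> \<open>Since \<open>N\<close> is null, the bound on the measure of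
      \<open>T - N\<close> is also one on that of \<open>T\<close>.\<close>
    obtain T where T: "open T" "N \<subseteq> T" "T - N \<in> lmeasurable" "emeasure lebesgue (T - N) < ennreal \<delta>"
      using sets_lebesgue_outer_open[of N \<delta>] N0 \<open>\<delta> > 0\<close> by blast
    have "T = (T - N) \<union> N" using T(2) by blast
    then have "emeasure lebesgue T = emeasure lebesgue (T - N)"
      using emeasure_Un_null_set[OF _ N0, of "T - N"] T(3) by (metis fmeasurableD)
    then have T': "T \<in> lmeasurable" "measure lebesgue T < \<delta>"
      using T \<open>\<delta> > 0\<close> by (auto simp: fmeasurable_def measure_def enn2real_less_iff
          intro: order.strict_trans)
    \<comment> \<open>The derivative gives a radius at points of \<open>{a..b} - N\<close>; radius 1
      serves elsewhere, so \<open>d\<close> can be chosen as a total positive function.\<close>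
    have "\<exists>d>0. x \<in> {a..b} - N \<longrightarrow>
        (\<forall>y\<in>{a..b}. norm (y - x) < d \<longrightarrow> norm (F y - F x - (y - x) *\<^sub>R h x) \<le> e1 * norm (y - x))" for x
      using deriv[of x, unfolded has_vector_derivative_def has_derivative_within_alt] \<open>e1 > 0\<close>
      by (cases "x \<in> {a..b} - N") (auto intro: exI[of _ 1])
    then obtain d where d: "\<And>x. 0 < d x"
      "\<And>x y. \<lbrakk>x \<in> {a..b} - N; y \<in> {a..b}; norm (y - x) < d x\<rbrakk>
          \<Longrightarrow> norm (F y - F x - (y - x) *\<^sub>R h x) \<le> e1 * norm (y - x)"
      by metis
    define \<gamma> where "\<gamma> x = (if x \<in> N then T else ball x (d x))" for x
    show "\<exists>\<gamma>. gauge \<gamma> \<and> (\<forall>\<D>. \<D> tagged_division_of cbox a b \<and> \<gamma> fine \<D> \<longrightarrow>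
        norm ((\<Sum>(x, k)\<in>\<D>. measure lborel k *\<^sub>R h' x) - (F b - F a)) < e)"
    proof (intro exI conjI allI impI)
      show "gauge \<gamma>"
        using T d(1) by (auto simp: gauge_def \<gamma>_def)
    next
      fix p assume p: "p tagged_division_of cbox a b \<and> \<gamma> fine p"
      then have ptag: "p tagged_division_of cbox a b" and fine: "\<gamma> fine p" by auto
      have fin: "finite p" using ptag by blast
      define q where "q = {z \<in> p. fst z \<in> N}"
      have q: "q tagged_partial_division_of cbox a b"
        using ptag tagged_partial_division_subset[of p "cbox a b" q]
        by (auto simp: q_def tagged_division_of_def)
      have qdiv: "snd ` q division_of \<Union>(snd ` q)"
        using partial_division_of_tagged_division[OF q] .
      have qsub: "\<Union>(snd ` q) \<subseteq> {a..b}"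
        using tagged_partial_division_ofD(3)[OF q] by fastforce
      have qT: "\<Union>(snd ` q) \<subseteq> T"
        using fine by (fastforce simp: q_def \<gamma>_def fine_def)
      have "(\<Sum>K\<in>snd ` q. Sup K - Inf K) \<le> measure lebesgue T"
        unfolding content_division_eq_measure[OF qdiv]
        using qT T'(1) lmeasurable_division[OF qdiv]
        by (intro measure_mono_fmeasurable) auto
      then have small: "(\<Sum>K\<in>snd ` q. cmod (F (Sup K) - F (Inf K))) < e / 2"
        using \<delta>[OF qdiv qsub] T'(2) by linarith
      \<comment> \<open>Absolute continuity sums over intervals, the Riemann sum over tagged pairs.
        One interval can carry two tags only if its interior is empty; it is then a single point and
        its increment is 0.\<close>
      have "(\<Sum>K\<in>snd ` q. cmod (F (Sup K) - F (Inf K))) = (\<Sum>z\<in>q. cmod (F (Sup (snd z)) - F (Inf (snd z))))"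
      proof (rule sum.reindex_nontrivial[unfolded o_def])
        show "finite q" using q by (rule tagged_partial_division_ofD)
        fix z w assume zw: "z \<in> q" "w \<in> q" "z \<noteq> w" "snd z = snd w"
        obtain x y K where z: "z = (x, K)" and w: "w = (y, K)"
          using zw(4) by (metis prod.collapse)
        have "x \<in> K" "interior K = {}"
          using tagged_partial_division_ofD(2)[OF q, of x K]
            tagged_partial_division_ofD(5)[OF q, of x K y K] zw z w by auto
        moreover obtain u v where "K = {u..v}"
          using tagged_partial_division_ofD(4)[OF q] zw(1) z by (metis box_real(2))
        ultimately have "K = {x}" by auto
        then show "cmod (F (Sup (snd z)) - F (Inf (snd z))) = 0"
          by (simp add: z)
      qed
      then have sumq: "(\<Sum>(x, K)\<in>q. cmod (F (Sup K) - F (Inf K))) = (\<Sum>K\<in>snd ` q. cmod (F (Sup K) - F (Inf K)))"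
        by (simp add: split_def)
      \<comment> \<open>Length and increment of \<open>F\<close> are additive over the division, so
        the error splits into one term per tagged interval.\<close>
      have ba: "b - a = (\<Sum>(x,K)\<in>p. Sup K - Inf K)" "F b - F a = (\<Sum>(x,K)\<in>p. F (Sup K) - F (Inf K))"
        using additive_tagged_division_1[where f = "\<lambda>x. x"] additive_tagged_division_1[where f = F]
          ab ptag by auto
      have "norm ((\<Sum>(x, k)\<in>p. measure lborel k *\<^sub>R h' x) - (F b - F a))
          = norm (\<Sum>(x, K)\<in>p. measure lborel K *\<^sub>R h' x - (F (Sup K) - F (Inf K)))"
        unfolding ba by (simp add: split_def sum_subtractf)
      also have "\<dots> \<le> (\<Sum>(x, K)\<in>p. e1 * (Sup K - Inf K) +
            (if x \<in> N then cmod (F (Sup K) - F (Inf K)) else 0))"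
      proof (rule sum_norm_le, safe)
        fix x K assume xK: "(x, K) \<in> p"
        then have "x \<in> K" and kab: "K \<subseteq> {a..b}"
          using ptag by (auto dest: tagged_division_ofD)
        obtain u v where k: "K = {u..v}"
          using tagged_division_ofD(4)[OF ptag xK] by auto
        then have uv: "u \<le> v" "u \<in> {a..b}" "v \<in> {a..b}" "x \<in> {a..b}" "u \<le> x" "x \<le> v"
          using \<open>x \<in> K\<close> kab by auto
        show "norm (measure lborel K *\<^sub>R h' x - (F (Sup K) - F (Inf K)))
            \<le> e1 * (Sup K - Inf K) + (if x \<in> N then cmod (F (Sup K) - F (Inf K)) else 0)"
        proof (cases "x \<in> N")
          case True
          then show ?thesis using uv \<open>e1 > 0\<close> by (simp add: h'_def k norm_minus_commute)
        next
          case False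
          have "K \<subseteq> ball x (d x)" using fine xK False by (force simp: fine_def \<gamma>_def)
          moreover have "u \<in> K" "v \<in> K" using k uv by auto
          ultimately have "u \<in> ball x (d x)" "v \<in> ball x (d x)" by blast+
          then have "norm (u - x) < d x" "norm (v - x) < d x"
            by (simp_all add: dist_norm abs_minus_commute)
          then have "norm (F u - F x - (u - x) *\<^sub>R h x) \<le> e1 * norm (u - x)"
            "norm (F v - F x - (v - x) *\<^sub>R h x) \<le> e1 * norm (v - x)"
            using d(2)[of x u] d(2)[of x v] False uv by blast+
          \<comment> \<open>The tag lies between the endpoints, so its distances to them add up to
            the length of the interval.\<close>
          moreover have "e1 * norm (u - x) + e1 * norm (v - x) = e1 * (v - u)"
            using uv by (simp add: algebra_simps)
          ultimately have "norm (F u - F x - (u - x) *\<^sub>R h x) + norm (F v - F x - (v - x) *\<^sub>R h x) \<le> e1 * (v - u)"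
            by linarith
          moreover have "(v - u) *\<^sub>R h x - (F v - F u)
              = (F u - F x - (u - x) *\<^sub>R h x) - (F v - F x - (v - x) *\<^sub>R h x)"
            by (simp add: algebra_simps)
          then have "norm ((v - u) *\<^sub>R h x - (F v - F u))
              \<le> norm (F u - F x - (u - x) *\<^sub>R h x) + norm (F v - F x - (v - x) *\<^sub>R h x)"
            using norm_triangle_ineq4[of "F u - F x - (u - x) *\<^sub>R h x" "F v - F x - (v - x) *\<^sub>R h x"]
            by (simp only:)
          ultimately show ?thesis
            using False uv by (simp add: h'_def k)
        qed
      qed
      also have "\<dots> = e1 * (b - a) + (\<Sum>(x, K)\<in>q. cmod (F (Sup K) - F (Inf K)))"
        unfolding ba q_def sum.inter_filter[OF fin] sum_distrib_left sum.distrib[symmetric]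
        by (intro sum.cong) auto
      also have "\<dots> < e"
        using e1 small sumq by linarith
      finally show "norm ((\<Sum>(x, k)\<in>p. measure lborel k *\<^sub>R h' x) - (F b - F a)) < e" .
    qed
  qed
  then show ?thesis
    using has_integral_spike[OF N, of "{a..b}" h h'] by (simp add: h'_def)
qed

section \<open>Closure properties of absolute continuity\<close>

lemma abs_continuous_on_interval_cong_imp:
  assumes eq: "\<And>x. x \<in> {a..b} \<Longrightarrow> f x = g x" and f: "abs_continuous_on_interval a b f"
  shows "abs_continuous_on_interval a b g"
  unfolding abs_continuous_on_interval_def
proof (intro allI impI)
  fix e :: real assume "e > 0"
  obtain \<delta> where \<delta>: "\<delta> > 0" "\<And>\<D>. \<D> division_of \<Union>\<D> \<Longrightarrow> \<Union>\<D> \<subseteq> {a..b} \<Longrightarrow>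
        (\<Sum>k\<in>\<D>. Sup k - Inf k) < \<delta> \<Longrightarrow> (\<Sum>k\<in>\<D>. cmod (f (Sup k) - f (Inf k))) < e"
    using abs_continuous_on_intervalE[OF f \<open>e > 0\<close>] by blast
  show "\<exists>\<delta>>0. \<forall>\<D>. \<D> division_of \<Union>\<D> \<and> \<Union>\<D> \<subseteq> {a..b} \<and> (\<Sum>k\<in>\<D>. Sup k - Inf k) < \<delta>
        \<longrightarrow> (\<Sum>k\<in>\<D>. cmod (g (Sup k) - g (Inf k))) < e"
  proof (intro exI[of _ \<delta>] conjI allI impI)
    fix \<D> :: "real set set"
    assume D: "\<D> division_of \<Union>\<D> \<and> \<Union>\<D> \<subseteq> {a..b} \<and> (\<Sum>k\<in>\<D>. Sup k - Inf k) < \<delta>"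
    have "(\<Sum>k\<in>\<D>. cmod (g (Sup k) - g (Inf k))) = (\<Sum>k\<in>\<D>. cmod (f (Sup k) - f (Inf k)))"
    proof (intro sum.cong refl)
      fix K assume "K \<in> \<D>"
      then obtain u v where uv: "K = {u..v}" "u \<le> v"
        using D division_ofD(3,4)[of \<D> "\<Union>\<D>" K] by (metis atLeastatMost_empty_iff box_real(2))
      moreover have "K \<subseteq> {a..b}" using D \<open>K \<in> \<D>\<close> by blast
      ultimately have "u \<in> {a..b}" "v \<in> {a..b}" by auto
      then show "cmod (g (Sup K) - g (Inf K)) = cmod (f (Sup K) - f (Inf K))"
        using uv eq by simp
    qed
    then show "(\<Sum>k\<in>\<D>. cmod (g (Sup k) - g (Inf k))) < e"
      using \<delta>(2)[of \<D>] D by linarith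
  qed (rule \<delta>(1))
qed

lemma abs_continuous_on_interval_cong:
  assumes "\<And>x. x \<in> {a..b} \<Longrightarrow> f x = g x"
  shows "abs_continuous_on_interval a b f \<longleftrightarrow> abs_continuous_on_interval a b g"
  using abs_continuous_on_interval_cong_imp[of a b f g] abs_continuous_on_interval_cong_imp[of a b g f]
    assms by auto

text \<open>Allows \<open>dx\<close> of a linear combination to be replaced by its formula, which is
  available only at positive arguments.\<close>

lemma AC_loc_halfline_cong:
  assumes "\<And>x. x > 0 \<Longrightarrow> f x = g x"
  shows "AC_loc_halfline f \<longleftrightarrow> AC_loc_halfline g"
  unfolding AC_loc_halfline_def
  using abs_continuous_on_interval_cong[of _ _ f g] assms by force

text \<open>The shape \<open>f x + k * g x\<close>, kept throughout, covers adding a multiple of the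
  defect vector, subtracting it, and the difference of two exponentials
  (\<open>k = -1\<close>).\<close>

lemma abs_continuous_on_interval_add_scale:
  assumes f: "abs_continuous_on_interval a b f" and g: "abs_continuous_on_interval a b g"
  shows "abs_continuous_on_interval a b (\<lambda>x. f x + k * g x)"
  unfolding abs_continuous_on_interval_def
proof (intro allI impI)
  fix e :: real assume "e > 0"
  \<comment> \<open>Adding 1 to \<open>cmod k\<close> avoids a zero denominator when
    \<open>k = 0\<close>.\<close>
  define e' where "e' = e / (2 * (cmod k + 1))"
  have "cmod k + 1 > 0" by (simp add: add_nonneg_pos)
  then have "e' > 0" and e': "cmod k * e' \<le> e / 2"
    using \<open>e > 0\<close> by (auto simp: e'_def field_simps)
  obtain d1 where d1: "d1 > 0" "\<And>\<D>. \<D> division_of \<Union>\<D> \<Longrightarrow> \<Union>\<D> \<subseteq> {a..b} \<Longrightarrow>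
        (\<Sum>k\<in>\<D>. Sup k - Inf k) < d1 \<Longrightarrow> (\<Sum>k\<in>\<D>. cmod (f (Sup k) - f (Inf k))) < e / 2"
    using abs_continuous_on_intervalE[OF f half_gt_zero[OF \<open>e > 0\<close>]] by blast
  obtain d2 where d2: "d2 > 0" "\<And>\<D>. \<D> division_of \<Union>\<D> \<Longrightarrow> \<Union>\<D> \<subseteq> {a..b} \<Longrightarrow>
        (\<Sum>k\<in>\<D>. Sup k - Inf k) < d2 \<Longrightarrow> (\<Sum>k\<in>\<D>. cmod (g (Sup k) - g (Inf k))) < e'"
    using abs_continuous_on_intervalE[OF g \<open>e' > 0\<close>] by blast
  show "\<exists>\<delta>>0. \<forall>\<D>. \<D> division_of \<Union>\<D> \<and> \<Union>\<D> \<subseteq> {a..b} \<and> (\<Sum>k\<in>\<D>. Sup k - Inf k) < \<delta>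
        \<longrightarrow> (\<Sum>K\<in>\<D>. cmod ((f (Sup K) + k * g (Sup K)) - (f (Inf K) + k * g (Inf K)))) < e"
  proof (intro exI[of _ "min d1 d2"] conjI allI impI)
    show "min d1 d2 > 0" using d1 d2 by simp
    fix \<D> :: "real set set"
    assume D: "\<D> division_of \<Union>\<D> \<and> \<Union>\<D> \<subseteq> {a..b} \<and> (\<Sum>k\<in>\<D>. Sup k - Inf k) < min d1 d2"
    have "(\<Sum>K\<in>\<D>. cmod ((f (Sup K) + k * g (Sup K)) - (f (Inf K) + k * g (Inf K))))
        \<le> (\<Sum>K\<in>\<D>. cmod (f (Sup K) - f (Inf K)) + cmod k * cmod (g (Sup K) - g (Inf K)))"
    proof (rule sum_mono)
      fix K
      have "(f (Sup K) + k * g (Sup K)) - (f (Inf K) + k * g (Inf K))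
          = (f (Sup K) - f (Inf K)) + k * (g (Sup K) - g (Inf K))"
        by (simp add: algebra_simps)
      then show "cmod ((f (Sup K) + k * g (Sup K)) - (f (Inf K) + k * g (Inf K)))
          \<le> cmod (f (Sup K) - f (Inf K)) + cmod k * cmod (g (Sup K) - g (Inf K))"
        by (metis norm_mult norm_triangle_ineq)
    qed
    also have "\<dots> = (\<Sum>K\<in>\<D>. cmod (f (Sup K) - f (Inf K))) + cmod k * (\<Sum>K\<in>\<D>. cmod (g (Sup K) - g (Inf K)))"
      by (simp add: sum.distrib sum_distrib_left)
    also have "\<dots> < e / 2 + e / 2"
    proof (rule add_less_le_mono)
      show "(\<Sum>K\<in>\<D>. cmod (f (Sup K) - f (Inf K))) < e / 2" using d1 D by auto
      have "cmod k * (\<Sum>K\<in>\<D>. cmod (g (Sup K) - g (Inf K))) \<le> cmod k * e'"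
        using d2(2)[of \<D>] D by (intro mult_left_mono) auto
      then show "cmod k * (\<Sum>K\<in>\<D>. cmod (g (Sup K) - g (Inf K))) \<le> e / 2" using e' by linarith
    qed
    finally show "(\<Sum>K\<in>\<D>. cmod ((f (Sup K) + k * g (Sup K)) - (f (Inf K) + k * g (Inf K)))) < e"
      by simp
  qed
qed

lemma AC_loc_halfline_add_scale:
  "AC_loc_halfline f \<Longrightarrow> AC_loc_halfline g \<Longrightarrow> AC_loc_halfline (\<lambda>x. f x + k * g x)"
  unfolding AC_loc_halfline_def using abs_continuous_on_interval_add_scale by blast

lemma abs_continuous_on_interval_lipschitz:
  assumes "C-lipschitz_on {a..b} f"
  shows "abs_continuous_on_interval a b f"
  unfolding abs_continuous_on_interval_def
proof (intro allI impI)
  fix e :: real assume "e > 0"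
  have C: "C \<ge> 0" using assms lipschitz_on_nonneg by blast
  show "\<exists>\<delta>>0. \<forall>\<D>. \<D> division_of \<Union>\<D> \<and> \<Union>\<D> \<subseteq> {a..b} \<and> (\<Sum>k\<in>\<D>. Sup k - Inf k) < \<delta>
        \<longrightarrow> (\<Sum>k\<in>\<D>. cmod (f (Sup k) - f (Inf k))) < e"
  \<comment> \<open>\<open>C + 1\<close> replaces \<open>C\<close> so that the quotient is positive
    also for \<open>C = 0\<close>.\<close>
  proof (intro exI[of _ "e / (C + 1)"] conjI allI impI)
    show "e / (C + 1) > 0" using \<open>e > 0\<close> C by simp
    fix \<D> :: "real set set"
    assume D: "\<D> division_of \<Union>\<D> \<and> \<Union>\<D> \<subseteq> {a..b} \<and> (\<Sum>k\<in>\<D>. Sup k - Inf k) < e / (C + 1)"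
    have "(\<Sum>k\<in>\<D>. cmod (f (Sup k) - f (Inf k))) \<le> (\<Sum>k\<in>\<D>. (C + 1) * (Sup k - Inf k))"
    proof (rule sum_mono)
      fix K assume "K \<in> \<D>"
      then obtain u v where uv: "K = {u..v}" "u \<le> v"
        using D division_ofD(3,4) by (metis atLeastatMost_empty_iff box_real(2))
      moreover have "K \<subseteq> {a..b}" using D \<open>K \<in> \<D>\<close> by blast
      ultimately have "cmod (f v - f u) \<le> C * (v - u)"
        using lipschitz_onD[OF assms, of v u] by (auto simp: dist_norm)
      also have "\<dots> \<le> (C + 1) * (v - u)" using uv by (simp add: mult_right_mono)
      finally show "cmod (f (Sup K) - f (Inf K)) \<le> (C + 1) * (Sup K - Inf K)" using uv by simp
    qed
    also have "\<dots> < e"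
      using D C pos_less_divide_eq[of "C + 1"] unfolding sum_distrib_left[symmetric]
      by (simp add: mult.commute)
    finally show "(\<Sum>k\<in>\<D>. cmod (f (Sup k) - f (Inf k))) < e" .
  qed
qed

section \<open>Continuous extension to the boundary point 0\<close>

lemma AC_loc_halfline_extends_continuously:
  assumes ac: "AC_loc_halfline F" and N: "negligible N"
    and deriv: "\<And>x. x > 0 \<Longrightarrow> x \<notin> N \<Longrightarrow> (F has_vector_derivative h x) (at x)"
    and int: "h integrable_on {0<..1}"
  obtains G where "continuous_on {0..1} G" "\<And>x. x \<in> {0<..1} \<Longrightarrow> G x = F x"
proof
  have "h integrable_on {0..1}"
  proof (rule integrable_spike_set[OF int])
    show "negligible {x \<in> {0<..1} - {0..1}. h x \<noteq> 0}"
      by (rule negligible_subset[OF negligible_empty]) auto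
    show "negligible {x \<in> {0..1} - {0<..1}. h x \<noteq> 0}"
      by (rule negligible_subset[OF negligible_sing[of 0]]) auto
  qed
  \<comment> \<open>This fixes the witness \<open>G\<close>: integrating back from 1 makes sense
    down to 0 because \<open>h\<close> is integrable there, and reproduces \<open>F\<close> at
    positive points.\<close>
  then show "continuous_on {0..1} (\<lambda>x. F 1 - integral {x..1} h)"
    by (intro continuous_intros indefinite_integral_continuous_1')
  fix x :: real assume x: "x \<in> {0<..1}"
  have "(h has_integral (F 1 - F x)) {x..1}"
  proof (rule fundamental_theorem_of_calculus_abs_continuous[OF _ _ N])
    show "x \<le> 1" "abs_continuous_on_interval x 1 F"
      using x ac by (simp_all add: AC_loc_halfline_def)
    show "(F has_vector_derivative h y) (at y within {x..1})" if "y \<in> {x..1} - N" for y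
      by (rule has_vector_derivative_at_within[OF deriv]) (use that x in auto)
  qed
  then show "F 1 - integral {x..1} h = F x"
    by (simp add: integral_unique)
qed

lemma bval_eqI: "(f \<longlongrightarrow> l) (at_right 0) \<Longrightarrow> bval f = l"
  unfolding bval_def by (rule tendsto_Lim[OF trivial_limit_at_right_real])

text \<open>\<open>Lim\<close> is a description operator and carries information only once
  convergence is known; the continuous function \<open>G\<close> supplies that convergence.\<close>

lemma tendsto_bval:
  assumes "continuous_on {0..1} G" "\<And>x. x \<in> {0<..1} \<Longrightarrow> G x = F x"
  shows "(F \<longlongrightarrow> bval F) (at_right 0)"
proof -
  have "(G \<longlongrightarrow> G 0) (at_right 0)"
    using bspec[OF assms(1)[unfolded continuous_on_def], of 0] by (simp add: at_within_Icc_at_right)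
  moreover have "\<forall>\<^sub>F x in at_right 0. G x = F x"
    unfolding eventually_at_right_field using assms(2) by (intro exI[of _ 1]) auto
  ultimately have "(F \<longlongrightarrow> G 0) (at_right 0)"
    by (rule Lim_transform_eventually)
  then show ?thesis
    using bval_eqI by simp
qed

section \<open>Square-integrable functions\<close>

text \<open>The interval has finite measure, so \<open>1 + (cmod (h x))\<^sup>2\<close> is
  integrable on it, and it dominates \<open>cmod (h x)\<close>.\<close>

lemma L2_halfline_integrable_on:
  assumes "L2_halfline h"
  shows "h integrable_on {0<..1}"
proof -
  have "(\<lambda>x. (cmod (h x))\<^sup>2) absolutely_integrable_on {0<..}"
    using assms unfolding L2_halfline_def
    by (simp add: set_integrable_def integrable_restrict_space)
  then have "(\<lambda>x. (cmod (h x))\<^sup>2) absolutely_integrable_on {0<..1}"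
    by (rule set_integrable_subset) auto
  then have sq: "(\<lambda>x. (cmod (h x))\<^sup>2) integrable_on {0<..1}"
    by (rule set_lebesgue_integral_eq_integral(1))
  have "{0<..1::real} \<in> lmeasurable"
    by (rule bounded_set_imp_lmeasurable) auto
  then have int: "(\<lambda>x. 1 + (cmod (h x))\<^sup>2) integrable_on {0<..1}"
    by (rule integrable_add[OF integrable_on_const sq])
  have "h \<in> borel_measurable (lebesgue_on {0<..})"
    using assms by (simp add: L2_halfline_def)
  then have "h \<in> borel_measurable (lebesgue_on {0<..1})"
    by (rule measurable_restrict_mono) auto
  moreover have "norm (h x) \<le> 1 + (cmod (h x))\<^sup>2" for x
    using zero_le_power2[of "cmod (h x) - 1/2"] by (simp add: power2_eq_square algebra_simps)
  ultimately have "h absolutely_integrable_on {0<..1}"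
    by (intro measurable_bounded_by_integrable_imp_absolutely_integrable[OF _ _ int]) simp_all
  then show ?thesis
    by (rule set_lebesgue_integral_eq_integral(1))
qed

lemma L2_halfline_add_scale:
  assumes f: "L2_halfline f" and g: "L2_halfline g"
  shows "L2_halfline (\<lambda>x. f x + k * g x)"
  unfolding L2_halfline_def
proof
  show meas: "(\<lambda>x. f x + k * g x) \<in> borel_measurable (lebesgue_on {0<..})"
    using f g unfolding L2_halfline_def by (intro borel_measurable_add borel_measurable_times) auto
  show "integrable (lebesgue_on {0<..}) (\<lambda>x. (cmod (f x + k * g x))\<^sup>2)"
  proof (rule Bochner_Integration.integrable_bound)
    show "integrable (lebesgue_on {0<..}) (\<lambda>x. 2 * (cmod (f x))\<^sup>2 + 2 * (cmod k)\<^sup>2 * (cmod (g x))\<^sup>2)"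
      using f g unfolding L2_halfline_def
      by (intro Bochner_Integration.integrable_add integrable_mult_right) auto
    show "(\<lambda>x. (cmod (f x + k * g x))\<^sup>2) \<in> borel_measurable (lebesgue_on {0<..})"
      using meas by measurable
    have "(cmod (f x + k * g x))\<^sup>2 \<le> 2 * (cmod (f x))\<^sup>2 + 2 * (cmod k)\<^sup>2 * (cmod (g x))\<^sup>2" for x
    proof -
      have "(cmod (f x + k * g x))\<^sup>2 \<le> (cmod (f x) + cmod k * cmod (g x))\<^sup>2"
        by (intro power_mono order.trans[OF norm_triangle_ineq]) (simp_all add: norm_mult)
      \<comment> \<open>The right side exceeds the left by the square of
        \<open>cmod (f x) - cmod k * cmod (g x)\<close>.\<close>
      also have "\<dots> \<le> 2 * (cmod (f x))\<^sup>2 + 2 * (cmod k * cmod (g x))\<^sup>2"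
        using zero_le_power2[of "cmod (f x) - cmod k * cmod (g x)"]
        by (simp add: power2_eq_square algebra_simps)
      finally show ?thesis by (simp add: power_mult_distrib)
    qed
    then show "AE x in lebesgue_on {0<..}. norm ((cmod (f x + k * g x))\<^sup>2)
        \<le> norm (2 * (cmod (f x))\<^sup>2 + 2 * (cmod k)\<^sup>2 * (cmod (g x))\<^sup>2)"
      by (intro AE_I2) simp
  qed
qed

section \<open>The maximal domain\<close>

lemma has_vector_derivative_dx:
  assumes "f differentiable_on {0<..}" "x > 0"
  shows "(f has_vector_derivative dx f x) (at x)"
  using assms by (simp add: dx_def differentiable_on_eq_differentiable_at vector_derivative_works[symmetric])

text \<open>The extension argument is applied twice, from the top derivative down. The second
  derivative is in L2, hence integrable near 0, so \<open>dx f\<close> extends continuously to 0; it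
  is then itself integrable near 0, so \<open>f\<close> extends too.\<close>

lemma Dom_K1_max_bval:
  assumes "f \<in> Dom_K1_max"
  shows "(f \<longlongrightarrow> bval f) (at_right 0)" "(dx f \<longlongrightarrow> bval (dx f)) (at_right 0)"
proof -
  obtain h where f: "AC_loc_halfline f" "f differentiable_on {0<..}" "AC_loc_halfline (dx f)"
    and h: "L2_halfline h" "AE x in lebesgue_on {0<..}. (dx f has_vector_derivative h x) (at x)"
    using assms unfolding Dom_K1_max_def by blast
  have "AE x in lebesgue. x > 0 \<longrightarrow> (dx f has_vector_derivative h x) (at x)"
    using h(2) by (simp add: AE_restrict_space_iff)
  then obtain N where N: "N \<in> null_sets lebesgue"
    "\<And>x. x > 0 \<Longrightarrow> x \<notin> N \<Longrightarrow> (dx f has_vector_derivative h x) (at x)"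
    by (elim AE_E3) auto
  obtain G where G: "continuous_on {0..1} G" "\<And>x. x \<in> {0<..1} \<Longrightarrow> G x = dx f x"
    using AC_loc_halfline_extends_continuously[OF f(3) _ N(2) L2_halfline_integrable_on[OF h(1)]] N(1)
    by (auto simp: negligible_iff_null_sets)
  then show "(dx f \<longlongrightarrow> bval (dx f)) (at_right 0)"
    by (rule tendsto_bval)
  have "G integrable_on {0..1}"
    using G(1) integrable_continuous_interval by blast
  then have "G integrable_on {0<..1}"
  proof (rule integrable_spike_set)
    show "negligible {x \<in> {0<..1} - {0..1}. G x \<noteq> 0}"
      by (rule negligible_subset[OF negligible_empty]) auto
    show "negligible {x \<in> {0..1} - {0<..1}. G x \<noteq> 0}"
      by (rule negligible_subset[OF negligible_sing[of 0]]) auto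
  qed
  then have "dx f integrable_on {0<..1}"
    using G(2) integrable_eq by blast
  \<comment> \<open>The exceptional set is empty here because \<open>f\<close> is differentiable at
    every positive point.\<close>
  then obtain G' where "continuous_on {0..1} G'" "\<And>x. x \<in> {0<..1} \<Longrightarrow> G' x = f x"
    using AC_loc_halfline_extends_continuously[OF f(1) negligible_empty, of "dx f"]
      has_vector_derivative_dx[OF f(2)] by blast
  then show "(f \<longlongrightarrow> bval f) (at_right 0)"
    by (rule tendsto_bval)
qed

lemma dx_add_scale:
  assumes "f differentiable_on {0<..}" "g differentiable_on {0<..}" "x > 0"
  shows "((\<lambda>x. f x + k * g x) has_vector_derivative dx f x + k * dx g x) (at x)"
    and "dx (\<lambda>x. f x + k * g x) x = dx f x + k * dx g x"
proof -
  show *: "((\<lambda>x. f x + k * g x) has_vector_derivative dx f x + k * dx g x) (at x)"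
    using assms by (intro has_vector_derivative_add has_vector_derivative_mult_right has_vector_derivative_dx)
  show "dx (\<lambda>x. f x + k * g x) x = dx f x + k * dx g x"
    unfolding dx_def[of "\<lambda>x. f x + k * g x"] using * by (rule vector_derivative_at)
qed

text \<open>Makes the maximal domain a vector space with the two boundary values as linear
  functionals; linearity of \<open>bval\<close> rests on the existence of the limits.\<close>

lemma Dom_K1_max_add_scale:
  assumes f: "f \<in> Dom_K1_max" and g: "g \<in> Dom_K1_max"
  shows "(\<lambda>x. f x + k * g x) \<in> Dom_K1_max"
    and "bval (\<lambda>x. f x + k * g x) = bval f + k * bval g"
    and "bval (dx (\<lambda>x. f x + k * g x)) = bval (dx f) + k * bval (dx g)"
proof -
  obtain h1 h2 where h: "L2_halfline h1" "L2_halfline h2"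
    "AE x in lebesgue_on {0<..}. (dx f has_vector_derivative h1 x) (at x)"
    "AE x in lebesgue_on {0<..}. (dx g has_vector_derivative h2 x) (at x)"
    using f g unfolding Dom_K1_max_def by blast
  have df: "f differentiable_on {0<..}" and dg: "g differentiable_on {0<..}"
    using f g unfolding Dom_K1_max_def by auto
  let ?s = "\<lambda>x. f x + k * g x"
  note dxs = dx_add_scale[OF df dg]
  show "?s \<in> Dom_K1_max"
    unfolding Dom_K1_max_def
  proof (intro CollectI conjI exI[of _ "\<lambda>x. h1 x + k * h2 x"])
    show "L2_halfline ?s" "AC_loc_halfline ?s" "L2_halfline (\<lambda>x. h1 x + k * h2 x)"
      using f g h L2_halfline_add_scale AC_loc_halfline_add_scale unfolding Dom_K1_max_def by auto
    show "?s differentiable_on {0<..}"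
      using df dg by (intro derivative_intros)
    have "AC_loc_halfline (\<lambda>x. dx f x + k * dx g x)"
      using f g AC_loc_halfline_add_scale unfolding Dom_K1_max_def by auto
    then show "AC_loc_halfline (dx ?s)"
      using AC_loc_halfline_cong[of "dx ?s" "\<lambda>x. dx f x + k * dx g x"] dxs(2) by simp
    \<comment> \<open>Positivity of \<open>x\<close> is recorded since the formula for
      \<open>dx ?s\<close> holds only on the open half-line, a neighbourhood of each of its
      points.\<close>
    have "AE x in lebesgue_on {0<..}. x \<in> {0<..}"
      by (intro AE_I2) simp
    then show "AE x in lebesgue_on {0<..}. (dx ?s has_vector_derivative h1 x + k * h2 x) (at x)"
      using h(3,4)
    proof eventually_elim
      case (elim x)
      then have "((\<lambda>x. dx f x + k * dx g x) has_vector_derivative h1 x + k * h2 x) (at x)"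
        by (intro has_vector_derivative_add has_vector_derivative_mult_right)
      then show ?case
        by (rule has_vector_derivative_transform_within_open[of _ _ _ "{0<..}"]) (use elim dxs(2) in auto)
    qed
  qed
  show "bval ?s = bval f + k * bval g"
    by (intro bval_eqI tendsto_intros Dom_K1_max_bval f g)
  have "((\<lambda>x. dx f x + k * dx g x) \<longlongrightarrow> bval (dx f) + k * bval (dx g)) (at_right 0)"
    by (intro tendsto_intros Dom_K1_max_bval f g)
  moreover have "\<forall>\<^sub>F x in at_right 0. dx f x + k * dx g x = dx ?s x"
    unfolding eventually_at_right_field using dxs(2) by (intro exI[of _ 1]) auto
  ultimately show "bval (dx ?s) = bval (dx f) + k * bval (dx g)"
    by (intro bval_eqI) (rule Lim_transform_eventually)
qed

section \<open>Decaying exponentials\<close>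

lemma has_vector_derivative_exp_scale:
  fixes A z :: complex
  shows
  "((\<lambda>x. A * exp (z * of_real x)) has_vector_derivative A * z * exp (z * of_real x)) (at x within S)"
  by (rule has_vector_derivative_real_field[of "\<lambda>w. A * exp (z * w)"]) (auto intro!: derivative_eq_intros)

lemma dx_exp_scale: "dx (\<lambda>x. A * exp (z * of_real x)) = (\<lambda>x. A * z * exp (z * of_real x))"
  unfolding dx_def by (intro ext vector_derivative_at has_vector_derivative_exp_scale)

lemma bval_exp_scale: "bval (\<lambda>x. A * exp (z * of_real x)) = A"
proof (rule bval_eqI)
  have "((\<lambda>x. A * exp (z * of_real x)) \<longlongrightarrow> A * exp (z * of_real 0)) (at_right 0)"
    by (intro tendsto_intros)
  then show "((\<lambda>x. A * exp (z * of_real x)) \<longlongrightarrow> A) (at_right 0)" by simp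
qed

lemma L2_halfline_exp:
  assumes "Re z < 0"
  shows "L2_halfline (\<lambda>x. A * exp (z * of_real x))"
  unfolding L2_halfline_def
proof
  have "continuous_on {0<..} (\<lambda>x. A * exp (z * complex_of_real x))"
    by (intro continuous_intros)
  then show "(\<lambda>x. A * exp (z * of_real x)) \<in> borel_measurable (lebesgue_on {0<..})"
    by (rule continuous_imp_measurable_on_sets_lebesgue) auto
  \<comment> \<open>The squared modulus decays at rate \<open>- 2 * Re z\<close>, which is positive;
    the double negation exhibits the form exp(-a x).\<close>
  have "(\<lambda>x. exp (- (- 2 * Re z) * x)) integrable_on {0..}"
    using assms by (intro integrable_on_exp_minus_to_infinity) auto
  then have "(\<lambda>x. exp (- (- 2 * Re z) * x)) absolutely_integrable_on {0..}"
    by (intro nonnegative_absolutely_integrable_1) auto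
  then have "(\<lambda>x. exp (- (- 2 * Re z) * x)) absolutely_integrable_on {0<..}"
    by (rule set_integrable_subset) auto
  then have "integrable (lebesgue_on {0<..}) (\<lambda>x. (cmod A)\<^sup>2 * exp (- (- 2 * Re z) * x))"
    by (intro integrable_mult_right) (simp add: set_integrable_def integrable_restrict_space)
  moreover have "(cmod (A * exp (z * of_real x)))\<^sup>2 = (cmod A)\<^sup>2 * exp (- (- 2 * Re z) * x)" for x
    by (simp add: norm_mult norm_exp_eq_Re power_mult_distrib power2_eq_square exp_add[symmetric])
  ultimately show "integrable (lebesgue_on {0<..}) (\<lambda>x. (cmod (A * exp (z * of_real x)))\<^sup>2)"
    by simp
qed

text \<open>The exponential factor has modulus at most 1 on the half-line, so the derivative is
  bounded by \<open>cmod (A * z)\<close> and the function is Lipschitz.\<close>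

lemma AC_loc_halfline_exp:
  assumes "Re z < 0"
  shows "AC_loc_halfline (\<lambda>x. A * exp (z * of_real x))"
  unfolding AC_loc_halfline_def
proof (intro allI impI)
  fix a b :: real assume ab: "0 < a \<and> a \<le> b"
  have "(cmod (A * z))-lipschitz_on {a..b} (\<lambda>x. A * exp (z * of_real x))"
  proof (rule bounded_derivative_imp_lipschitz[OF
        has_vector_derivative_exp_scale[unfolded has_vector_derivative_def]])
    fix x assume x: "x \<in> {a..b}"
    have "Re z * x \<le> 0" using x ab assms by (simp add: mult_nonpos_nonneg)
    then have "cmod (A * z * exp (z * of_real x)) \<le> cmod (A * z)"
      by (simp add: norm_mult norm_exp_eq_Re mult_left_le)
    then show "onorm (\<lambda>h. h *\<^sub>R (A * z * exp (z * of_real x))) \<le> cmod (A * z)"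
      by (simp add: onorm_scaleR_left[OF bounded_linear_ident] onorm_id)
  qed auto
  then show "abs_continuous_on_interval a b (\<lambda>x. A * exp (z * of_real x))"
    by (rule abs_continuous_on_interval_lipschitz)
qed

text \<open>Differentiation only replaces \<open>A\<close> by \<open>A * z\<close>, so the lemmas on
  L2 and absolute continuity serve the derivatives as well.\<close>

lemma exp_in_Dom_K1_max:
  assumes "Re z < 0"
  shows "(\<lambda>x. A * exp (z * of_real x)) \<in> Dom_K1_max"
  unfolding Dom_K1_max_def mem_Collect_eq dx_exp_scale
proof (intro conjI exI[of _ "\<lambda>x. A * z * z * exp (z * of_real x)"])
  show "(\<lambda>x. A * exp (z * of_real x)) differentiable_on {0<..}"
    using has_vector_derivative_exp_scale differentiableI_vector
    unfolding differentiable_on_def by blast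
  show "AE x in lebesgue_on {0<..}. ((\<lambda>x. A * z * exp (z * of_real x)) has_vector_derivative
      A * z * z * exp (z * of_real x)) (at x)"
    by (intro AE_I2 has_vector_derivative_exp_scale)
qed (intro L2_halfline_exp AC_loc_halfline_exp assms)+

section \<open>The two descriptions of the extension domain\<close>

text \<open>The angles \<pi>/4 and 3\<pi>/4 are mirror images in the imaginary axis. This gives the
  sign of the real part needed for decay, and shows that the imaginary parts add up rather than
  cancel.\<close>

lemma sqrt_minus_i_eq: "sqrt_minus_i = - cnj sqrt_i"
proof -
  have "3 * pi / 4 = pi - pi / 4" by simp
  then have "cos (3 * pi / 4) = - cos (pi / 4)" "sin (3 * pi / 4) = sin (pi / 4)"
    by (simp_all only: cos_pi_minus sin_pi_minus)
  then show ?thesis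
    by (simp add: sqrt_minus_i_def sqrt_i_def complex_eq_iff)
qed

text \<open>Both exponents have negative real part, so the combination is one of decaying
  exponentials, whose boundary values are read off from coefficients and exponents.\<close>

lemma defect_combination:
  defines "r \<equiv> complex_of_real (root 4 2)"
  shows "(\<lambda>x. \<alpha> * phi_minus x - phi_plus x) \<in> Dom_K1_max"
    and "bval (\<lambda>x. \<alpha> * phi_minus x - phi_plus x) = r * (\<alpha> - 1)"
    and "bval (dx (\<lambda>x. \<alpha> * phi_minus x - phi_plus x)) = - r * (\<alpha> * sqrt_i + sqrt_minus_i)"
proof -
  have "Re (- sqrt_i) < 0" "Re sqrt_minus_i < 0"
    by (auto simp: sqrt_minus_i_eq sqrt_i_def cos_45)
  then have phi: "(\<lambda>x. (\<alpha> * r) * exp (- sqrt_i * of_real x)) \<in> Dom_K1_max"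
    "(\<lambda>x. r * exp (sqrt_minus_i * of_real x)) \<in> Dom_K1_max"
    by (intro exp_in_Dom_K1_max; simp)+
  have eq: "(\<lambda>x. \<alpha> * phi_minus x - phi_plus x)
      = (\<lambda>x. (\<alpha> * r) * exp (- sqrt_i * of_real x) + (-1) * (r * exp (sqrt_minus_i * of_real x)))"
    by (simp add: phi_minus_def phi_plus_def r_def fun_eq_iff)
  note sums = Dom_K1_max_add_scale[OF phi, of "-1"]
  show "(\<lambda>x. \<alpha> * phi_minus x - phi_plus x) \<in> Dom_K1_max"
    unfolding eq by (rule sums(1))
  show "bval (\<lambda>x. \<alpha> * phi_minus x - phi_plus x) = r * (\<alpha> - 1)"
    unfolding eq sums(2) bval_exp_scale by (simp add: algebra_simps)
  show "bval (dx (\<lambda>x. \<alpha> * phi_minus x - phi_plus x)) = - r * (\<alpha> * sqrt_i + sqrt_minus_i)"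
    unfolding eq sums(3) dx_exp_scale bval_exp_scale by (simp add: algebra_simps)
qed

theorem proposition2:
  fixes b c \<alpha> :: complex
  assumes "cmod b = 1" and "cmod c = 1" and "b * cnj c \<in> \<real>" and "cmod \<alpha> = 1"
    and "\<alpha> = (b + c * sqrt_minus_i) / (b - c * sqrt_i)"
  shows "Dom_K1_rank_one \<alpha> = Dom_K1_bc b c"
proof -
  define \<psi> where "\<psi> x = \<alpha> * phi_minus x - phi_plus x" for x
  define p q where "p = bval \<psi>" and "q = bval (dx \<psi>)"
  define r where "r = complex_of_real (root 4 2)"
  have "r \<noteq> 0" by (simp add: r_def)
  have \<psi>: "\<psi> \<in> Dom_K1_max" and p: "p = r * (\<alpha> - 1)" and q: "q = - r * (\<alpha> * sqrt_i + sqrt_minus_i)"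
    using defect_combination[of \<alpha>] unfolding p_def q_def \<psi>_def r_def by auto
  have "b \<noteq> 0" "c \<noteq> 0" using assms(1,2) by auto
  \<comment> \<open>The denominator of \<alpha> must be nonzero before it can be cleared. Otherwise
    \<open>b * cnj c\<close> would be \<open>sqrt_i\<close>, which is not real.\<close>
  have "b \<noteq> c * sqrt_i"
  proof
    assume "b = c * sqrt_i"
    then have "b * cnj c = sqrt_i * (c * cnj c)" by simp
    also have "c * cnj c = 1" using assms(2) by (simp add: complex_norm_square[symmetric])
    finally have "Im sqrt_i = 0" using assms(3) by (simp add: complex_is_Real_iff)
    then show False by (simp add: sqrt_i_def sin_45)
  qed
  then have "\<alpha> * (b - c * sqrt_i) = b + c * sqrt_minus_i"
    using assms(5) by (simp add: field_simps)
  \<comment> \<open>Up to the factor \<open>r\<close>, the left side is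
    \<open>\<alpha> * (b - c * sqrt_i) - (b + c * sqrt_minus_i)\<close>.\<close>
  then have bc: "b * p + c * q = 0"
    unfolding p q by algebra
  \<comment> \<open>Needed to divide by \<open>p\<close> below. If \<open>p = 0\<close>, then
    \<alpha> is 1 and \<open>q = 0\<close>, forcing \<open>sqrt_i + sqrt_minus_i\<close> to vanish,
    although its imaginary part is twice that of \<open>sqrt_i\<close>.\<close>
  have "p \<noteq> 0"
  proof
    assume "p = 0"
    then have "\<alpha> = 1" using p \<open>r \<noteq> 0\<close> by simp
    moreover have "q = 0" using bc \<open>p = 0\<close> \<open>c \<noteq> 0\<close> by simp
    ultimately have "Im (sqrt_i + sqrt_minus_i) = 0" using q \<open>r \<noteq> 0\<close> by simp
    then show False by (simp add: sqrt_minus_i_eq sqrt_i_def sin_45)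
  qed
  show ?thesis
  proof (intro equalityI subsetI)
    fix f assume "f \<in> Dom_K1_rank_one \<alpha>"
    then obtain g k where g: "g \<in> Dom_K1_min" and f: "f = (\<lambda>x. g x + k * \<psi> x)"
      unfolding Dom_K1_rank_one_def \<psi>_def by blast
    then have gmax: "g \<in> Dom_K1_max" "bval g = 0" "bval (dx g) = 0"
      unfolding Dom_K1_min_def by auto
    have "b * (k * p) + c * (k * q) = 0" using bc by algebra
    then show "f \<in> Dom_K1_bc b c"
      unfolding Dom_K1_bc_def f
      using Dom_K1_max_add_scale[OF gmax(1) \<psi>, of k] gmax by (simp add: p_def q_def)
  next
    fix f assume "f \<in> Dom_K1_bc b c"
    then have f: "f \<in> Dom_K1_max" "b * bval f + c * bval (dx f) = 0"
      unfolding Dom_K1_bc_def by auto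
    \<comment> \<open>Chosen so that subtracting \<open>k\<close> times \<psi> cancels the value at
      0. The boundary condition shared by \<open>f\<close> and \<psi> then cancels the derivative at
      0 as well, as \<open>c\<close> is nonzero.\<close>
    define k where "k = bval f / p"
    have k: "bval f = k * p" using \<open>p \<noteq> 0\<close> by (simp add: k_def)
    have "c * bval (dx f) = c * (k * q)"
      using f(2) bc unfolding k by algebra
    then have k': "bval (dx f) = k * q" using \<open>c \<noteq> 0\<close> by simp
    have "(\<lambda>x. f x + - k * \<psi> x) \<in> Dom_K1_min"
      unfolding Dom_K1_min_def
      using Dom_K1_max_add_scale[OF f(1) \<psi>, of "- k"] k k' by (simp add: p_def q_def)
    moreover have "f = (\<lambda>x. (f x + - k * \<psi> x) + k * \<psi> x)" by simp
    ultimately have "\<exists>g k. f = (\<lambda>x. g x + k * \<psi> x) \<and> g \<in> Dom_K1_min"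
      by (intro exI conjI)
    then show "f \<in> Dom_K1_rank_one \<alpha>"
      unfolding Dom_K1_rank_one_def \<psi>_def by blast
  qed
qed

end
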